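(* The conditional term rewriting systems $\mathrm{CLC}$ and $\mathrm{CLC}^+$ are confluent: for each $R\in\{\mathrm{CLC},\mathrm{CLC}^+\}$ and all terms $q,q_1,q_2$, if $q\to_R^* q_1$ and $q\to_R^* q_2$ then there is a term $q'$ with $q_1\to_R^* q'$ and $q_2\to_R^* q'$.
   Context: Terms are built from variables and the constants $C,T,F,K,S$ by binary application (written by juxtaposition, associating to the left). $\mathrm{CLC}$ is the conditional term rewriting system with rules $C\,T\,x\,y\to x$; $C\,F\,x\,y\to y$; $C\,z\,x\,y\to x \Leftarrow x=y$; $K\,x\,y\to x$; $S\,x\,y\,z\to x\,z\,(y\,z)$, where the equality $=$ in the condition is convertibility in the system itself. Formally: let $R_0$ be the system with the condition interpreted as the empty relation, and $R_{n+1}$ the system with $=$ interpreted as the conversion relation (reflexive–symmetric–transitive closure) of $\to_{R_n}$; then $q\to_{\mathrm{CLC}} q'$ iff $q\to_{R_n}q'$ for some $n$. Rewriting is closed under contexts. $\mathrm{CLC}^+$ is defined in the same way from the rules of $\mathrm{CLC}$ together with the additional rule $C\,z\,x\,y\to y\Leftarrow x=y$. For a rewrite system $R$, $\to_R^*$ is the reflexive–transitive closure of $\to_R$ and $=_R$ the conversion relation. *)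

theory Defs
  imports Main
begin

datatype trm = Var nat | CC | TT | FF | KK | SS | App trm trm (infixl "\<cdot>" 100)

text \<open>One-step rewriting, with the condition x = y interpreted by the relation E.
  The flag pl selects whether the extra rule C z x y -> y <= x = y (of CLC+) is present.\<close>

inductive cstep :: "bool \<Rightarrow> (trm \<Rightarrow> trm \<Rightarrow> bool) \<Rightarrow> trm \<Rightarrow> trm \<Rightarrow> bool"
  for pl :: bool and E :: "trm \<Rightarrow> trm \<Rightarrow> bool" where
  ruleCT: "cstep pl E (CC \<cdot> TT \<cdot> x \<cdot> y) x"
| ruleCF: "cstep pl E (CC \<cdot> FF \<cdot> x \<cdot> y) y"
| ruleCeq: "E x y \<Longrightarrow> cstep pl E (CC \<cdot> z \<cdot> x \<cdot> y) x"
| ruleCeq2: "pl \<Longrightarrow> E x y \<Longrightarrow> cstep pl E (CC \<cdot> z \<cdot> x \<cdot> y) y"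
| ruleK: "cstep pl E (KK \<cdot> x \<cdot> y) x"
| ruleS: "cstep pl E (SS \<cdot> x \<cdot> y \<cdot> z) (x \<cdot> z \<cdot> (y \<cdot> z))"
| appL: "cstep pl E s s' \<Longrightarrow> cstep pl E (s \<cdot> t) (s' \<cdot> t)"
| appR: "cstep pl E t t' \<Longrightarrow> cstep pl E (s \<cdot> t) (s \<cdot> t')"

fun Rn :: "bool \<Rightarrow> nat \<Rightarrow> trm \<Rightarrow> trm \<Rightarrow> bool" where
  "Rn pl 0 = cstep pl (\<lambda>_ _. False)"
| "Rn pl (Suc n) = cstep pl (equivclp (Rn pl n))"

definition step :: "bool \<Rightarrow> trm \<Rightarrow> trm \<Rightarrow> bool" where
  "step pl q q' \<longleftrightarrow> (\<exists>n. Rn pl n q q')"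

abbreviation CLC :: "trm \<Rightarrow> trm \<Rightarrow> bool" where "CLC \<equiv> step False"
abbreviation CLCplus :: "trm \<Rightarrow> trm \<Rightarrow> bool" where "CLCplus \<equiv> step True"

definition confluent_rel :: "(trm \<Rightarrow> trm \<Rightarrow> bool) \<Rightarrow> bool" where
  "confluent_rel R \<longleftrightarrow> (\<forall>q q1 q2. R\<^sup>*\<^sup>* q q1 \<and> R\<^sup>*\<^sup>* q q2 \<longrightarrow> (\<exists>q'. R\<^sup>*\<^sup>* q1 q' \<and> R\<^sup>*\<^sup>* q2 q'))"

end

theory Submission
  imports Defs
begin

text \<open>Convertibility in both systems is the equational theory Eq of K, S, C T x y = x, C F x y = y
  and C z x x = x, and CLC is contained in CLC+; so it is enough to join Eq-equal terms in CLC.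
  The only obstacle to confluence of CLC is the overlap of C F x y \<open>\<rightarrow>\<close> y with
  C z x y \<open>\<rightarrow>\<close> x if x = y. It disappears in the system with the rules K, S, C T x y \<open>\<rightarrow>\<close> x,
  C z x y \<open>\<rightarrow>\<close> y if z = F, and C z x y \<open>\<rightarrow>\<close> x if x = y and not z = F, where = is Eq:
  this system is orthogonal, hence confluent, and its conversion is again Eq. CLC simulates it as
  soon as z = F implies that z rewrites to F. To see the latter, evaluate terms in head position,
  letting C z x y take a Boolean value when z evaluates to T or F and the selected branch has this
  value, or when x = y and both branches have it. Evaluation is realised by rewriting in CLC
  and is invariant under Eq.\<close>

section \<open>The equational theory shared by both systems\<close>

inductive ax :: "trm \<Rightarrow> trm \<Rightarrow> bool" where
  "ax (CC \<cdot> TT \<cdot> x \<cdot> y) x"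
| "ax (CC \<cdot> FF \<cdot> x \<cdot> y) y"
| "ax (CC \<cdot> z \<cdot> x \<cdot> x) x"
| "ax (KK \<cdot> x \<cdot> y) x"
| "ax (SS \<cdot> x \<cdot> y \<cdot> z) (x \<cdot> z \<cdot> (y \<cdot> z))"

text \<open>Replacement is parallel so that when \<open>SS\<close> duplicates an argument, all
  copies can change within one step; the invariance of evaluation relies on this.\<close>

inductive ax_par :: "trm \<Rightarrow> trm \<Rightarrow> bool" where
  ax_par_refl: "ax_par t t"
| ax_par_ax: "ax l r \<Longrightarrow> ax_par l r"
| ax_par_sym_ax: "ax l r \<Longrightarrow> ax_par r l"
| ax_par_App: "ax_par s s' \<Longrightarrow> ax_par t t' \<Longrightarrow> ax_par (s \<cdot> t) (s' \<cdot> t')"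

abbreviation Eq :: "trm \<Rightarrow> trm \<Rightarrow> bool" where
  "Eq \<equiv> ax_par\<^sup>*\<^sup>*"

lemma ax_par_sym: "ax_par s t \<Longrightarrow> ax_par t s"
  by (induction rule: ax_par.induct) (auto intro: ax_par.intros)

lemma Eq_sym: "Eq s t \<Longrightarrow> Eq t s"
  by (induction rule: rtranclp_induct) (auto intro: ax_par_sym converse_rtranclp_into_rtranclp)

lemma Eq_App:
  assumes "Eq s s'" and "Eq t t'"
  shows "Eq (s \<cdot> t) (s' \<cdot> t')"
proof -
  have "Eq (s \<cdot> t) (s' \<cdot> t)"
    using assms(1) by induction (auto intro: rtranclp.rtrancl_into_rtrancl ax_par.intros)
  moreover have "Eq (s' \<cdot> t) (s' \<cdot> t')"
    using assms(2) by induction (auto intro: rtranclp.rtrancl_into_rtrancl ax_par.intros)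
  ultimately show ?thesis by (rule rtranclp_trans)
qed

lemma Eq_ax: "ax l r \<Longrightarrow> Eq l r"
  by (blast intro: ax_par_ax)

text \<open>Both conditional rules follow from C z x x = x once the hypothesis on \<open>E\<close>
  lets one branch replace the other.\<close>

lemma cstep_imp_Eq:
  assumes "cstep pl E s t" and "\<And>x y. E x y \<Longrightarrow> Eq x y"
  shows "Eq s t"
  using assms(1)
proof induction
  case (ruleCeq x y z)
  have "Eq (CC \<cdot> z \<cdot> x \<cdot> y) (CC \<cdot> z \<cdot> x \<cdot> x)"
    using Eq_sym[OF assms(2)[OF ruleCeq]] by (intro Eq_App) auto
  then show ?case
    using Eq_ax[OF ax.intros(3)] by (rule rtranclp_trans)
next
  case (ruleCeq2 x y z)
  have "Eq (CC \<cdot> z \<cdot> x \<cdot> y) (CC \<cdot> z \<cdot> y \<cdot> y)"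
    using assms(2)[OF ruleCeq2(2)] by (intro Eq_App) auto
  then show ?case
    using Eq_ax[OF ax.intros(3)] by (rule rtranclp_trans)
qed (auto intro: Eq_ax ax.intros Eq_App)

lemma Rn_imp_Eq: "Rn pl n s t \<Longrightarrow> Eq s t"
proof (induction n arbitrary: s t)
  case 0
  then show ?case by (auto intro: cstep_imp_Eq)
next
  case (Suc n)
  have "Eq x y" if "equivclp (Rn pl n) x y" for x y
    using that
    by (induction rule: equivclp_induct) (blast intro: Suc.IH Eq_sym rtranclp_trans)+
  with Suc.prems show ?case by (auto intro: cstep_imp_Eq)
qed

lemma steps_imp_Eq: "(step pl)\<^sup>*\<^sup>* s t \<Longrightarrow> Eq s t"
  by (induction rule: rtranclp_induct) (auto simp: step_def dest: Rn_imp_Eq)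

lemma equivclp_Rn_App:
  assumes "equivclp (Rn pl n) s s'" and "equivclp (Rn pl n) t t'"
  shows "equivclp (Rn pl n) (s \<cdot> t) (s' \<cdot> t')"
proof -
  have appL: "Rn pl n (u \<cdot> w) (v \<cdot> w)" and appR: "Rn pl n (w \<cdot> u) (w \<cdot> v)"
    if "Rn pl n u v" for u v w
    using that by (cases n; auto intro: cstep.appL cstep.appR)+
  have "equivclp (Rn pl n) (s \<cdot> t) (s' \<cdot> t)"
    using assms(1) by (induction rule: equivclp_induct) (auto intro: appL equivclp_into_equivclp)
  moreover have "equivclp (Rn pl n) (s' \<cdot> t) (s' \<cdot> t')"
    using assms(2) by (induction rule: equivclp_induct) (auto intro: appR equivclp_into_equivclp)
  ultimately show ?thesis by (rule equivclp_trans)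
qed

text \<open>The condition for contracting C z x x is x = x, which holds by reflexivity in the
  conversion of \<open>Rn pl 0\<close>. Level 1 therefore has all axioms as steps.\<close>

lemma ax_imp_R1: "ax l r \<Longrightarrow> Rn pl (Suc 0) l r"
  by (induction rule: ax.induct) (auto intro: cstep.intros)

lemma Eq_imp_conv_R1:
  assumes "Eq s t"
  shows "equivclp (Rn pl (Suc 0)) s t"
proof -
  have "equivclp (Rn pl (Suc 0)) u v" if "ax_par u v" for u v
    using that
  proof induction
    case (ax_par_ax l r)
    then show ?case by (blast intro: ax_imp_R1 r_into_equivclp)
  next
    case (ax_par_sym_ax l r)
    then show ?case by (blast intro: ax_imp_R1 r_into_equivclp equivclp_sym)
  next
    case (ax_par_App s s' t t')
    then show ?case by (blast intro: equivclp_Rn_App)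
  qed simp
  with assms show ?thesis
    by (induction rule: rtranclp_induct) (auto intro: equivclp_trans)
qed

lemma step_App:
  assumes "(step pl)\<^sup>*\<^sup>* s s'" and "(step pl)\<^sup>*\<^sup>* t t'"
  shows "(step pl)\<^sup>*\<^sup>* (s \<cdot> t) (s' \<cdot> t')"
proof -
  have appL: "step pl (u \<cdot> w) (v \<cdot> w)" and appR: "step pl (w \<cdot> u) (w \<cdot> v)"
    if "step pl u v" for u v w
  proof -
    from that obtain n where n: "Rn pl n u v" by (auto simp: step_def)
    have "Rn pl n (u \<cdot> w) (v \<cdot> w)" "Rn pl n (w \<cdot> u) (w \<cdot> v)"
      using n by (cases n; auto intro: cstep.appL cstep.appR)+
    then show "step pl (u \<cdot> w) (v \<cdot> w)" "step pl (w \<cdot> u) (w \<cdot> v)"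
      by (auto simp: step_def)
  qed
  have "(step pl)\<^sup>*\<^sup>* (s \<cdot> t) (s' \<cdot> t)"
    using assms(1) by induction (auto intro: appL rtranclp.rtrancl_into_rtrancl)
  moreover have "(step pl)\<^sup>*\<^sup>* (s' \<cdot> t) (s' \<cdot> t')"
    using assms(2) by induction (auto intro: appR rtranclp.rtrancl_into_rtrancl)
  ultimately show ?thesis by (rule rtranclp_trans)
qed

lemma step_root:
  "step pl (KK \<cdot> x \<cdot> y) x"
  "step pl (SS \<cdot> x \<cdot> y \<cdot> z) (x \<cdot> z \<cdot> (y \<cdot> z))"
  "step pl (CC \<cdot> TT \<cdot> x \<cdot> y) x"
  "step pl (CC \<cdot> FF \<cdot> x \<cdot> y) y"
  "Eq x y \<Longrightarrow> step pl (CC \<cdot> z \<cdot> x \<cdot> y) x"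
proof -
  \<comment> \<open>Level 2 tests its conditions in the conversion of level 1, which contains
    \<open>Eq\<close>.\<close>
  have *: "step pl s t" if "cstep pl (equivclp (Rn pl (Suc 0))) s t" for s t
    unfolding step_def using that by (intro exI[of _ "Suc (Suc 0)"]) simp
  show "step pl (KK \<cdot> x \<cdot> y) x"
    "step pl (SS \<cdot> x \<cdot> y \<cdot> z) (x \<cdot> z \<cdot> (y \<cdot> z))"
    "step pl (CC \<cdot> TT \<cdot> x \<cdot> y) x"
    "step pl (CC \<cdot> FF \<cdot> x \<cdot> y) y"
    "Eq x y \<Longrightarrow> step pl (CC \<cdot> z \<cdot> x \<cdot> y) x"
    by (rule *, blast intro: cstep.intros Eq_imp_conv_R1)+
qed

subsection \<open>Head evaluation to a Boolean constant\<close>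

text \<open>\<open>ev t rs v\<close> evaluates \<open>t\<close> applied to the list \<open>rs\<close>. Evaluating both branches in
  \<open>ev_eq\<close> makes evaluation invariant under C F x y = y and C z x x = x alike.\<close>

inductive ev :: "trm \<Rightarrow> trm list \<Rightarrow> trm \<Rightarrow> bool" where
  ev_TT: "ev TT [] TT"
| ev_FF: "ev FF [] FF"
| ev_App: "ev s (t # rs) v \<Longrightarrow> ev (s \<cdot> t) rs v"
| ev_KK: "ev x rs v \<Longrightarrow> ev KK (x # y # rs) v"
| ev_SS: "ev x (z # (y \<cdot> z) # rs) v \<Longrightarrow> ev SS (x # y # z # rs) v"
| ev_true: "ev z [] TT \<Longrightarrow> ev x rs v \<Longrightarrow> ev CC (z # x # y # rs) v"
| ev_false: "ev z [] FF \<Longrightarrow> ev y rs v \<Longrightarrow> ev CC (z # x # y # rs) v"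
| ev_eq: "Eq x y \<Longrightarrow> ev x rs v \<Longrightarrow> ev y rs v \<Longrightarrow> ev CC (z # x # y # rs) v"

inductive_cases ev_AppE: "ev (s \<cdot> t) rs v"
inductive_cases ev_KKE: "ev KK (x # y # rs) v"
inductive_cases ev_SSE: "ev SS (x # y # z # rs) v"
inductive_cases ev_CCE: "ev CC (z # x # y # rs) v"
inductive_cases ev_TTE: "ev TT [] v"
inductive_cases ev_FFE: "ev FF [] v"

lemma ev_ax:
  assumes "ax l r"
  shows "ev l rs v \<longleftrightarrow> ev r rs v"
  using assms
  by cases
    (auto intro!: ev_App ev_true[OF ev_TT] ev_false[OF ev_FF] ev_eq[OF rtranclp.rtrancl_refl]
        ev_KK ev_SS
      elim!: ev_AppE ev_KKE ev_SSE ev_CCE elim: ev_TTE ev_FFE)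

text \<open>Axioms at the root of the head are settled by \<open>ev_ax\<close> over a fixed stack,
  which leaves only the congruence case to each use.\<close>

lemma ax_par_cases_ev:
  assumes "ax_par t t'" and "ev t rs v"
    and "\<And>s u s' u'. t = s \<cdot> u \<Longrightarrow> t' = s' \<cdot> u' \<Longrightarrow> ax_par s s' \<Longrightarrow> ax_par u u' \<Longrightarrow> ev t' rs v"
  shows "ev t' rs v"
  using assms(1)
  by cases (use assms ev_ax in auto)

text \<open>Head and stack vary together because \<open>ev_App\<close> moves an argument from the
  former to the latter.\<close>

lemma ev_ax_par:
  "ev t rs v \<Longrightarrow> ax_par t t' \<Longrightarrow> list_all2 ax_par rs rs' \<Longrightarrow> ev t' rs' v"
proof (induction arbitrary: t' rs' rule: ev.induct)
  case ev_TT
  then show ?case by (auto intro: ax_par_cases_ev ev.intros)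
next
  case ev_FF
  then show ?case by (auto intro: ax_par_cases_ev ev.intros)
next
  case (ev_App s t rs v)
  \<comment> \<open>The stack changes first, under the old head, since \<open>ev_ax\<close> compares
    two heads over the same stack.\<close>
  have "ev (s \<cdot> t) rs' v"
    using ev_App.IH[of s "t # rs'"] ev_App.prems by (auto intro: ev.ev_App ax_par_refl)
  with ev_App.prems(1) show ?case
    by (rule ax_par_cases_ev) (use ev_App.IH ev_App.prems in \<open>auto intro!: ev.ev_App\<close>)
next
  case (ev_KK x rs v y)
  from ev_KK.prems(2) obtain x' y' rs'' where [simp]: "rs' = x' # y' # rs''"
    and "ax_par x x'" "list_all2 ax_par rs rs''" by (auto simp: list_all2_Cons1)
  then have "ev KK rs' v" using ev_KK.IH by (auto intro: ev.ev_KK)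
  with ev_KK.prems(1) show ?case by (rule ax_par_cases_ev) simp
next
  case (ev_SS x z y rs v)
  from ev_SS.prems(2) obtain x' y' z' rs'' where [simp]: "rs' = x' # y' # z' # rs''"
    and "ax_par x x'" "ax_par y y'" "ax_par z z'" "list_all2 ax_par rs rs''"
    by (auto simp: list_all2_Cons1)
  then have "ev SS rs' v" using ev_SS.IH[of x' "z' # (y' \<cdot> z') # rs''"]
    by (auto intro!: ev.ev_SS ax_par_App)
  with ev_SS.prems(1) show ?case by (rule ax_par_cases_ev) simp
next
  case (ev_true z x rs v y)
  from ev_true.prems(2) obtain z' x' y' rs'' where [simp]: "rs' = z' # x' # y' # rs''"
    and "ax_par z z'" "ax_par x x'" "list_all2 ax_par rs rs''"
    by (auto simp: list_all2_Cons1)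
  then have "ev CC rs' v" using ev_true.IH by (auto intro: ev.ev_true)
  with ev_true.prems(1) show ?case by (rule ax_par_cases_ev) simp
next
  case (ev_false z y rs v x)
  from ev_false.prems(2) obtain z' x' y' rs'' where [simp]: "rs' = z' # x' # y' # rs''"
    and "ax_par z z'" "ax_par y y'" "list_all2 ax_par rs rs''"
    by (auto simp: list_all2_Cons1)
  then have "ev CC rs' v" using ev_false.IH by (auto intro: ev.ev_false)
  with ev_false.prems(1) show ?case by (rule ax_par_cases_ev) simp
next
  case (ev_eq x y rs v z)
  from ev_eq.prems(2) obtain z' x' y' rs'' where [simp]: "rs' = z' # x' # y' # rs''"
    and xy: "ax_par x x'" "ax_par y y'" and rs: "list_all2 ax_par rs rs''"
    by (auto simp: list_all2_Cons1)
  have "Eq x' y'"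
    using xy ev_eq.hyps(1)
    by (meson ax_par_sym converse_rtranclp_into_rtranclp rtranclp.rtrancl_into_rtrancl)
  then have "ev CC rs' v" using ev_eq.IH xy rs by (auto intro: ev.ev_eq)
  with ev_eq.prems(1) show ?case by (rule ax_par_cases_ev) simp
qed

lemma ev_Eq: "Eq s t \<Longrightarrow> ev s [] v \<Longrightarrow> ev t [] v"
  by (induction rule: rtranclp_induct) (auto intro: ev_ax_par)

lemma steps_foldl_App:
  "(step pl)\<^sup>*\<^sup>* s t \<Longrightarrow> (step pl)\<^sup>*\<^sup>* (foldl App s rs) (foldl App t rs)"
  by (induction rs arbitrary: s t) (auto intro: step_App)

text \<open>Each evaluation rule becomes a reduction of the reassembled term. A value of z rewrites
  the selector to \<open>TT\<close> or \<open>FF\<close>; \<open>ev_eq\<close> becomes the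
  contraction to x, a rule of both systems.\<close>

lemma ev_imp_steps: "ev t rs v \<Longrightarrow> (step pl)\<^sup>*\<^sup>* (foldl App t rs) v"
proof (induction rule: ev.induct)
  case (ev_KK x rs v y)
  have "(step pl)\<^sup>*\<^sup>* (foldl App (KK \<cdot> x \<cdot> y) rs) (foldl App x rs)"
    by (intro steps_foldl_App r_into_rtranclp step_root)
  with ev_KK.IH show ?case by simp
next
  case (ev_SS x z y rs v)
  have "(step pl)\<^sup>*\<^sup>* (foldl App (SS \<cdot> x \<cdot> y \<cdot> z) rs) (foldl App (x \<cdot> z \<cdot> (y \<cdot> z)) rs)"
    by (intro steps_foldl_App r_into_rtranclp step_root)
  with ev_SS.IH show ?case by simp
next
  case (ev_true z x rs v y)
  have "(step pl)\<^sup>*\<^sup>* (CC \<cdot> z \<cdot> x \<cdot> y) (CC \<cdot> TT \<cdot> x \<cdot> y)"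
    using ev_true.IH(1) by (intro step_App) auto
  then have "(step pl)\<^sup>*\<^sup>* (CC \<cdot> z \<cdot> x \<cdot> y) x"
    using step_root(3) by (rule rtranclp.rtrancl_into_rtrancl)
  from steps_foldl_App[OF this] ev_true.IH(2) show ?case
    by simp (rule rtranclp_trans)
next
  case (ev_false z y rs v x)
  have "(step pl)\<^sup>*\<^sup>* (CC \<cdot> z \<cdot> x \<cdot> y) (CC \<cdot> FF \<cdot> x \<cdot> y)"
    using ev_false.IH(1) by (intro step_App) auto
  then have "(step pl)\<^sup>*\<^sup>* (CC \<cdot> z \<cdot> x \<cdot> y) y"
    using step_root(4) by (rule rtranclp.rtrancl_into_rtrancl)
  from steps_foldl_App[OF this] ev_false.IH(2) show ?case
    by simp (rule rtranclp_trans)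
next
  case (ev_eq x y rs v z)
  have "(step pl)\<^sup>*\<^sup>* (foldl App (CC \<cdot> z \<cdot> x \<cdot> y) rs) (foldl App x rs)"
    using step_root(5)[OF ev_eq.hyps(1)] by (intro steps_foldl_App r_into_rtranclp)
  with ev_eq.IH(1) show ?case by simp
qed simp_all

text \<open>\<open>FF\<close> evaluates to itself, hence by invariance so does every z equal to it,
  and evaluation is realised by rewriting.\<close>

lemma Eq_FF_imp_steps: "Eq z FF \<Longrightarrow> (step pl)\<^sup>*\<^sup>* z FF"
  using ev_imp_steps[OF ev_Eq[OF Eq_sym ev_FF]] by simp

text \<open>Consistency of the theory: \<open>TT\<close> would otherwise evaluate to
  \<open>FF\<close>. It keeps \<open>ostep_TT\<close> and \<open>ostep_FF\<close> from
  overlapping.\<close>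

lemma not_Eq_TT_FF: "\<not> Eq TT FF"
  using ev_Eq[OF Eq_sym ev_FF] ev_TTE by blast

subsection \<open>An orthogonal system with the same conversion\<close>

text \<open>Parallel reduction. The side condition of \<open>ostep_eq\<close> separates it from \<open>ostep_FF\<close>, and all
  conditions are stated modulo \<open>Eq\<close>, so they persist when the arguments are reduced.\<close>

inductive ostep :: "trm \<Rightarrow> trm \<Rightarrow> bool" where
  ostep_refl: "ostep t t"
| ostep_App: "ostep s s' \<Longrightarrow> ostep t t' \<Longrightarrow> ostep (s \<cdot> t) (s' \<cdot> t')"
| ostep_KK: "ostep x x' \<Longrightarrow> ostep (KK \<cdot> x \<cdot> y) x'"
| ostep_SS: "ostep x x' \<Longrightarrow> ostep y y' \<Longrightarrow> ostep z z' \<Longrightarrow> ostep (SS \<cdot> x \<cdot> y \<cdot> z) (x' \<cdot> z' \<cdot> (y' \<cdot> z'))"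
| ostep_TT: "ostep x x' \<Longrightarrow> ostep (CC \<cdot> TT \<cdot> x \<cdot> y) x'"
| ostep_FF: "Eq z FF \<Longrightarrow> ostep y y' \<Longrightarrow> ostep (CC \<cdot> z \<cdot> x \<cdot> y) y'"
| ostep_eq: "Eq x y \<Longrightarrow> \<not> Eq z FF \<Longrightarrow> ostep x x' \<Longrightarrow> ostep (CC \<cdot> z \<cdot> x \<cdot> y) x'"

lemma ostep_imp_steps: "ostep s t \<Longrightarrow> (step pl)\<^sup>*\<^sup>* s t"
proof (induction rule: ostep.induct)
  case (ostep_App s s' t t')
  then show ?case by (intro step_App)
next
  case (ostep_KK x x' y)
  then show ?case by (blast intro: step_root converse_rtranclp_into_rtranclp)
next
  case (ostep_SS x x' y y' z z')
  then have "(step pl)\<^sup>*\<^sup>* (x \<cdot> z \<cdot> (y \<cdot> z)) (x' \<cdot> z' \<cdot> (y' \<cdot> z'))" by (intro step_App)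
  then show ?case by (blast intro: step_root converse_rtranclp_into_rtranclp)
next
  case (ostep_TT x x' y)
  then show ?case by (blast intro: step_root converse_rtranclp_into_rtranclp)
next
  case (ostep_FF z y y' x)
  \<comment> \<open>The guard gives only equality with \<open>FF\<close>; rewriting z to
    \<open>FF\<close> itself makes the unconditional rule applicable.\<close>
  have "(step pl)\<^sup>*\<^sup>* (CC \<cdot> z \<cdot> x \<cdot> y) (CC \<cdot> FF \<cdot> x \<cdot> y)"
    using Eq_FF_imp_steps[OF ostep_FF.hyps(1)] by (intro step_App) auto
  with ostep_FF.IH show ?case
    by (meson step_root(4) converse_rtranclp_into_rtranclp rtranclp_trans)
next
  case (ostep_eq x y z x')
  then show ?case by (blast intro: step_root converse_rtranclp_into_rtranclp)
qed simp

lemma ostep_imp_Eq: "ostep s t \<Longrightarrow> Eq s t"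
  using ostep_imp_steps steps_imp_Eq by blast

inductive_cases ostep_constE: "ostep KK t" "ostep SS t" "ostep CC t" "ostep TT t"
  "ostep (Var n) t" "ostep FF t"
inductive_cases ostep_App1E: "ostep (KK \<cdot> x) t" "ostep (SS \<cdot> x) t" "ostep (CC \<cdot> x) t"
inductive_cases ostep_App2E: "ostep (SS \<cdot> x \<cdot> y) t" "ostep (CC \<cdot> x \<cdot> y) t"
inductive_cases ostep_AppE: "ostep (s \<cdot> t) u"

text \<open>A rule constant with too few arguments is no redex, so reduction stays inside the
  arguments. This excludes overlaps below the root of a redex.\<close>

lemma ostep_App1D:
  "ostep (KK \<cdot> x) t \<Longrightarrow> \<exists>x'. t = KK \<cdot> x' \<and> ostep x x'"
  "ostep (SS \<cdot> x) t \<Longrightarrow> \<exists>x'. t = SS \<cdot> x' \<and> ostep x x'"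
  "ostep (CC \<cdot> x) t \<Longrightarrow> \<exists>x'. t = CC \<cdot> x' \<and> ostep x x'"
  by (auto elim!: ostep_App1E ostep_constE intro: ostep_refl)

lemma ostep_App2D:
  "ostep (SS \<cdot> x \<cdot> y) t \<Longrightarrow> \<exists>x' y'. t = SS \<cdot> x' \<cdot> y' \<and> ostep x x' \<and> ostep y y'"
  "ostep (CC \<cdot> x \<cdot> y) t \<Longrightarrow> \<exists>x' y'. t = CC \<cdot> x' \<cdot> y' \<and> ostep x x' \<and> ostep y y'"
  by (auto elim!: ostep_App2E dest!: ostep_App1D intro: ostep_refl)

text \<open>\<open>ostep\<close> stays within an \<open>Eq\<close> class, so conditions persist, and
  so do negated ones.\<close>

lemma Eq_ostep_cong: "ostep x x' \<Longrightarrow> ostep y y' \<Longrightarrow> Eq x' y' \<longleftrightarrow> Eq x y"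
  by (meson ostep_imp_Eq Eq_sym rtranclp_trans)

text \<open>Takahashi's triangle property: u is the complete development of t, assembled from the
  developments of its immediate parts or, at a root redex, of the arguments that survive.\<close>

lemma ostep_triangle: "\<exists>u. \<forall>s. ostep t s \<longrightarrow> ostep s u"
proof (induction "size t" arbitrary: t rule: less_induct)
  case less
  consider x y where "t = KK \<cdot> x \<cdot> y" | x y z where "t = SS \<cdot> x \<cdot> y \<cdot> z"
    | x y where "t = CC \<cdot> TT \<cdot> x \<cdot> y"
    | z x y where "t = CC \<cdot> z \<cdot> x \<cdot> y" "z \<noteq> TT" "Eq z FF"
    | z x y where "t = CC \<cdot> z \<cdot> x \<cdot> y" "z \<noteq> TT" "\<not> Eq z FF" "Eq x y"
    | "\<nexists>x y. t = KK \<cdot> x \<cdot> y" "\<nexists>x y z. t = SS \<cdot> x \<cdot> y \<cdot> z"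
      "\<nexists>x y. t = CC \<cdot> TT \<cdot> x \<cdot> y"
      "\<nexists>z x y. t = CC \<cdot> z \<cdot> x \<cdot> y \<and> (Eq z FF \<or> Eq x y)"
    by metis
  then show ?case
  proof cases
    case 1
    with less[of x] obtain u where "\<forall>s. ostep x s \<longrightarrow> ostep s u" by auto
    then have "ostep s u" if "ostep t s" for s
      using that unfolding 1
      by (elim ostep_AppE[of "KK \<cdot> x" y]) (auto dest!: ostep_App1D intro: ostep_KK ostep_refl)
    then show ?thesis by blast
  next
    case 2
    with less[of x] less[of y] less[of z] obtain u v w where
      "\<forall>s. ostep x s \<longrightarrow> ostep s u" "\<forall>s. ostep y s \<longrightarrow> ostep s v" "\<forall>s. ostep z s \<longrightarrow> ostep s w" by auto
    then have "ostep s (u \<cdot> w \<cdot> (v \<cdot> w))" if "ostep t s" for s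
      using that unfolding 2
      by (elim ostep_AppE[of "SS \<cdot> x \<cdot> y" z]) (auto dest!: ostep_App2D, (blast intro: ostep.intros)+)
    then show ?thesis by blast
  next
    \<comment> \<open>If x = y, then \<open>ostep_eq\<close> applies as well, but it selects the
      same branch; \<open>ostep_FF\<close> is excluded by \<open>not_Eq_TT_FF\<close>.\<close>
    case 3
    with less[of x] obtain u where "\<forall>s. ostep x s \<longrightarrow> ostep s u" by auto
    then have "ostep s u" if "ostep t s" for s
      using that unfolding 3
      by (elim ostep_AppE[of "CC \<cdot> TT \<cdot> x" y])
        (auto dest!: ostep_App2D elim!: ostep_constE simp: not_Eq_TT_FF intro: ostep_TT ostep_refl)
    then show ?thesis by blast
  next
    case 4
    with less[of y] obtain u where "\<forall>s. ostep y s \<longrightarrow> ostep s u" by auto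
    moreover have "Eq z' FF" if "ostep z z'" for z'
      using that 4(3) Eq_ostep_cong[OF _ ostep_refl] by blast
    ultimately have "ostep s u" if "ostep t s" for s
      using that 4(2,3) unfolding 4(1)
      by (elim ostep_AppE[of "CC \<cdot> z \<cdot> x" y]) (auto dest!: ostep_App2D intro: ostep_FF ostep_refl)
    then show ?thesis by blast
  next
    case 5
    with less[of x] obtain u where "\<forall>s. ostep x s \<longrightarrow> ostep s u" by auto
    moreover have "\<not> Eq z' FF" if "ostep z z'" for z'
      using that 5(3) Eq_ostep_cong[OF _ ostep_refl] by blast
    moreover have "Eq x' y'" if "ostep x x'" "ostep y y'" for x' y'
      using that 5(4) Eq_ostep_cong by blast
    ultimately have "ostep s u" if "ostep t s" for s
      using that 5(2-4) unfolding 5(1)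
      by (elim ostep_AppE[of "CC \<cdot> z \<cdot> x" y]) (auto dest!: ostep_App2D intro: ostep_eq ostep_refl)
    then show ?thesis by blast
  next
    case 6
    show ?thesis
    proof (cases t)
      case (App a b)
      with less[of a] less[of b] obtain u v where
        "\<forall>s. ostep a s \<longrightarrow> ostep s u" "\<forall>s. ostep b s \<longrightarrow> ostep s v" by auto
      then have "ostep s (u \<cdot> v)" if "ostep t s" for s
        using that 6 unfolding App by (elim ostep_AppE) (auto intro: ostep_App ostep_refl)
      then show ?thesis by blast
    qed (auto elim!: ostep_constE intro: ostep_refl)
  qed
qed

section \<open>From the triangle property to confluence of both systems\<close>

lemma ostep_strip:
  assumes "ostep\<^sup>*\<^sup>* t s" and "ostep t r"
  shows "\<exists>u. ostep s u \<and> ostep\<^sup>*\<^sup>* r u"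
  using assms
proof (induction arbitrary: r rule: converse_rtranclp_induct)
  case (step t t')
  obtain w where "ostep t' w" "ostep r w" using ostep_triangle step.hyps(1) step.prems by blast
  with step.IH show ?case by (meson converse_rtranclp_into_rtranclp)
qed blast

lemma ostep_confluent:
  assumes "ostep\<^sup>*\<^sup>* s u" and "ostep\<^sup>*\<^sup>* s v"
  shows "\<exists>w. ostep\<^sup>*\<^sup>* u w \<and> ostep\<^sup>*\<^sup>* v w"
  using assms(2,1)
proof (induction arbitrary: u rule: converse_rtranclp_induct)
  case (step s s')
  then obtain w where "ostep u w" "ostep\<^sup>*\<^sup>* s' w" using ostep_strip by blast
  with step.IH show ?case by (meson converse_rtranclp_into_rtranclp)
qed blast

lemma ostep_steps_App:
  assumes "ostep\<^sup>*\<^sup>* s s'" and "ostep\<^sup>*\<^sup>* t t'"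
  shows "ostep\<^sup>*\<^sup>* (s \<cdot> t) (s' \<cdot> t')"
proof -
  have "ostep\<^sup>*\<^sup>* (s \<cdot> t) (s' \<cdot> t)"
    using assms(1) by induction (auto intro: rtranclp.rtrancl_into_rtrancl ostep.intros)
  moreover have "ostep\<^sup>*\<^sup>* (s' \<cdot> t) (s' \<cdot> t')"
    using assms(2) by induction (auto intro: rtranclp.rtrancl_into_rtrancl ostep.intros)
  ultimately show ?thesis by (rule rtranclp_trans)
qed

lemma ax_imp_ostep: "ax l r \<Longrightarrow> ostep l r"
proof (induction rule: ax.induct)
  case (3 z x)
  \<comment> \<open>With equal branches, either guard yields x: \<open>ostep_FF\<close> as the
    second branch, \<open>ostep_eq\<close> as the first.\<close>
  then show ?case by (cases "Eq z FF") (auto intro: ostep.intros)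
qed (auto intro: ostep.intros)

lemma ax_par_imp_joinable: "ax_par s t \<Longrightarrow> \<exists>u. ostep\<^sup>*\<^sup>* s u \<and> ostep\<^sup>*\<^sup>* t u"
  by (induction rule: ax_par.induct) (blast intro: ax_imp_ostep ostep_steps_App)+

text \<open>The Church-Rosser property of \<open>ostep\<close>: the joins on the two sides of each
  intermediate term are merged by confluence.\<close>

lemma Eq_imp_joinable: "Eq s t \<Longrightarrow> \<exists>u. ostep\<^sup>*\<^sup>* s u \<and> ostep\<^sup>*\<^sup>* t u"
proof (induction rule: rtranclp_induct)
  case (step t r)
  then obtain u v where "ostep\<^sup>*\<^sup>* s u" "ostep\<^sup>*\<^sup>* t u" "ostep\<^sup>*\<^sup>* t v" "ostep\<^sup>*\<^sup>* r v"
    using ax_par_imp_joinable by blast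
  with ostep_confluent show ?case by (meson rtranclp_trans)
qed blast

lemma confluent_step: "confluent_rel (step pl)"
  unfolding confluent_rel_def
proof (intro allI impI, elim conjE)
  fix q q1 q2
  assume "(step pl)\<^sup>*\<^sup>* q q1" "(step pl)\<^sup>*\<^sup>* q q2"
  then have "Eq q1 q2" by (meson steps_imp_Eq Eq_sym rtranclp_trans)
  then obtain u where "ostep\<^sup>*\<^sup>* q1 u" "ostep\<^sup>*\<^sup>* q2 u" using Eq_imp_joinable by blast
  moreover have "(step pl)\<^sup>*\<^sup>* s t" if "ostep\<^sup>*\<^sup>* s t" for s t
    using that by induction (auto intro: rtranclp_trans ostep_imp_steps)
  ultimately show "\<exists>q'. (step pl)\<^sup>*\<^sup>* q1 q' \<and> (step pl)\<^sup>*\<^sup>* q2 q'" by blast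
qed

theorem mainTheorem1:
  shows "confluent_rel CLC \<and> confluent_rel CLCplus"
  by (simp add: confluent_step)

end
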